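(* Let $\phi\in\mathbf{K}[z]$ be a polynomial of degree three. If the $\mathbf{K}$-rational Julia set $J_\phi(\mathbf{K})$ of $\phi$ is non-empty, then it contains a repelling fixed point of $\phi$.
   Context: $\mathbf{K}$ is a field endowed with a non-Archimedean discrete valuation $v$ with value group $\mathbf{Z}$, and $(\mathbf{K},v)$ is assumed henselian. The valuation $v$ extends uniquely to an algebraic closure of $\mathbf{K}$; $\mathbf{C}_v$ denotes the completion of this algebraic closure, with the extended valuation still denoted $v$ and $|\cdot|$ an associated absolute value. For a rational map $\phi\in\mathbf{K}(z)$, acting on $\mathbf{P}^1(\mathbf{C}_v)$, the Julia set $J_\phi\subset\mathbf{P}^1(\mathbf{C}_v)$ is the set of points around which the family of iterates $\{\phi^i\}_{i\ge 0}$ is not equicontinuous with respect to the chordal metric on $\mathbf{P}^1(\mathbf{C}_v)$, i.e. the metric $\rho([x_1,y_1],[x_2,y_2])=\dfrac{|x_1y_2-x_2y_1|}{\max(|x_1|,|y_1|)\max(|x_2|,|y_2|)}$. The $\mathbf{K}$-rational Julia set is $J_\phi(\mathbf{K})=J_\phi\cap\mathbf{P}^1(\mathbf{K})$. A fixed point of $\phi$ is a point $z\in\mathbf{C}_v$ with $\phi(z)=z$; it is repelling if $v(\phi'(z))<0$ (equivalently $|\phi'(z)|>1$). *)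

theory Defs
  imports
    "HOL-Analysis.Analysis"
    "HOL-Computational_Algebra.Computational_Algebra"
    "HOL-Algebra.Algebraic_Closure_Type"
begin

section \<open>Valued fields\<close>

locale valued_field =
  fixes v :: "'a :: field \<Rightarrow> ereal"
  assumes val_not_MInf: "v x \<noteq> -\<infinity>"
    and val_eq_PInf_iff: "v x = \<infinity> \<longleftrightarrow> x = 0"
    and val_mult: "v (x * y) = v x + v y"
    and val_add: "min (v x) (v y) \<le> v (x + y)"

text \<open>
  The assumption \<open>hensel\<close> below is Hensel's lemma in its root-lifting form: a simple root modulo the
  maximal ideal of a polynomial over the valuation ring lifts to a root.
\<close>

locale henselian_discrete_field = valued_field v for v :: "'a :: field \<Rightarrow> ereal" +
  assumes value_group: "v ` (UNIV - {0}) = range (\<lambda>n :: int. ereal (real_of_int n))"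
    and hensel: "\<lbrakk>\<And>i. 0 \<le> v (Polynomial.coeff f i); 0 \<le> v a; 0 < v (poly f a); v (poly (pderiv f) a) = 0\<rbrakk>
                  \<Longrightarrow> \<exists>x. poly f x = 0 \<and> 0 < v (x - a)"

definition val_abs :: "real \<Rightarrow> ('a :: field \<Rightarrow> ereal) \<Rightarrow> 'a \<Rightarrow> real" where
  "val_abs b v x = (if x = 0 then 0 else b powr (- real_of_ereal (v x)))"

definition val_dist :: "real \<Rightarrow> ('a :: field \<Rightarrow> ereal) \<Rightarrow> 'a \<Rightarrow> 'a \<Rightarrow> real" where
  "val_dist b v x y = val_abs b v (x - y)"

context valued_field
begin

lemma val_one: "v 1 = 0"
  using val_mult[of 1 1] val_not_MInf[of 1] val_eq_PInf_iff[of 1] by (cases "v 1") auto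

lemma val_minus: "v (- x) = v x"
proof -
  have "v (-1) + v (-1) = 0" using val_mult[of "-1" "-1"] val_one by simp
  hence "v (-1) = 0" by (cases "v (-1)") auto
  thus ?thesis using val_mult[of "-1" x] by simp
qed

context
  fixes b :: real
  assumes b: "b > 1"
begin

lemma val_abs_nonneg: "0 \<le> val_abs b v x"
  by (simp add: val_abs_def)

lemma val_abs_eq_0_iff: "val_abs b v x = 0 \<longleftrightarrow> x = 0"
  using b by (simp add: val_abs_def)

lemma val_abs_minus: "val_abs b v (- x) = val_abs b v x"
  by (simp add: val_abs_def val_minus)

lemma val_abs_mult: "val_abs b v (x * y) = val_abs b v x * val_abs b v y"
proof (cases "x = 0 \<or> y = 0")
  case False
  hence "v x \<noteq> \<infinity>" "v y \<noteq> \<infinity>" using val_eq_PInf_iff by auto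
  hence "real_of_ereal (v (x * y)) = real_of_ereal (v x) + real_of_ereal (v y)"
    using val_not_MInf[of x] val_not_MInf[of y] by (cases "v x"; cases "v y") (auto simp: val_mult)
  thus ?thesis using False b by (simp add: val_abs_def powr_add[symmetric])
qed (auto simp: val_abs_def)

lemma val_abs_ultrametric: "val_abs b v (x + y) \<le> max (val_abs b v x) (val_abs b v y)"
proof (cases "x = 0 \<or> y = 0 \<or> x + y = 0")
  case True
  thus ?thesis using val_abs_nonneg[of x] val_abs_nonneg[of y] by (auto simp: val_abs_def le_max_iff_disj)
next
  case False
  hence "v x \<noteq> \<infinity>" "v y \<noteq> \<infinity>" "v (x + y) \<noteq> \<infinity>" using val_eq_PInf_iff by auto
  hence "min (real_of_ereal (v x)) (real_of_ereal (v y)) \<le> real_of_ereal (v (x + y))"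
    using val_add[of x y] val_not_MInf[of x] val_not_MInf[of y] val_not_MInf[of "x + y"]
    by (cases "v x"; cases "v y"; cases "v (x + y)") (auto simp: min_def split: if_splits)
  thus ?thesis using False b by (auto simp: val_abs_def le_max_iff_disj min_le_iff_disj)
qed

lemma Metric_space_val_dist: "Metric_space UNIV (val_dist b v)"
proof
  fix x y z
  show "0 \<le> val_dist b v x y" by (simp add: val_dist_def val_abs_nonneg)
  show "val_dist b v x y = val_dist b v y x"
    using val_abs_minus[of "x - y"] by (simp add: val_dist_def)
  show "val_dist b v x y = 0 \<longleftrightarrow> x = y" by (simp add: val_dist_def val_abs_eq_0_iff)
  show "val_dist b v x z \<le> val_dist b v x y + val_dist b v y z"
    using val_abs_ultrametric[of "x - y" "y - z"] val_abs_nonneg[of "x - y"]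
      val_abs_nonneg[of "y - z"] by (simp add: val_dist_def)
qed

end

end

text \<open>
  The completion of the algebraic closure of \<open>(K, v)\<close> is given by its characterisation up to
  isometric isomorphism: \<open>w\<close> is a valuation on the algebraic closure extending \<open>v\<close>, and \<open>(C, u)\<close>
  is a complete valued field containing \<open>(alg_closure K, w)\<close> isometrically, via \<open>j\<close>, as a dense
  subfield. The choice of \<open>b > 1\<close> normalising the absolute value does not affect completeness
  or density.
\<close>

locale completed_alg_closure =
  base: valued_field v + closure: valued_field w + compl: valued_field u
  for v :: "'k :: field \<Rightarrow> ereal"
    and w :: "'k alg_closure \<Rightarrow> ereal"
    and u :: "'c :: field \<Rightarrow> ereal"
    and j :: "'k alg_closure \<Rightarrow> 'c"
    and b :: real +
  assumes base_gt_1: "b > 1"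
    and w_extends: "w (to_ac x) = v x"
    and j_one: "j 1 = 1"
    and j_add: "j (y + z) = j y + j z"
    and j_mult: "j (y * z) = j y * j z"
    and u_extends: "u (j y) = w y"
    and complete: "Metric_space.mcomplete UNIV (val_dist b u)"
    and dense: "Metric_space.mtopology UNIV (val_dist b u) closure_of range j = UNIV"

section \<open>The projective line and the chordal metric\<close>

datatype 'c proj_line = Aff 'c | Infty

fun hom_coords :: "'c :: field proj_line \<Rightarrow> 'c \<times> 'c" where
  "hom_coords (Aff z) = (z, 1)"
| "hom_coords Infty = (1, 0)"

definition chordal :: "('c :: field \<Rightarrow> real) \<Rightarrow> 'c proj_line \<Rightarrow> 'c proj_line \<Rightarrow> real" where
  "chordal absv p q =
     (let (x1, y1) = hom_coords p; (x2, y2) = hom_coords q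
      in absv (x1 * y2 - x2 * y1) / (max (absv x1) (absv y1) * max (absv x2) (absv y2)))"

text \<open>
  The formula for the chordal metric may be evaluated in arbitrary homogeneous coordinates.
\<close>

definition of_hom :: "'c :: field \<Rightarrow> 'c \<Rightarrow> 'c proj_line" where
  "of_hom x y = (if y = 0 then Infty else Aff (x / y))"

lemma of_hom_scale:
  assumes "(x, y) \<noteq> (0, 0)"
  obtains t where "t \<noteq> 0" "x = t * fst (hom_coords (of_hom x y))"
    "y = t * snd (hom_coords (of_hom x y))"
proof (cases "y = 0")
  case True
  thus ?thesis using that[of x] assms by (simp add: of_hom_def)
next
  case False
  thus ?thesis using that[of y] by (simp add: of_hom_def)
qed

lemma (in valued_field) chordal_of_hom:
  assumes "b > 1" "(x1, y1) \<noteq> (0, 0)" "(x2, y2) \<noteq> (0, 0)"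
  defines "absv \<equiv> val_abs b v"
  shows "chordal absv (of_hom x1 y1) (of_hom x2 y2) =
    absv (x1 * y2 - x2 * y1) / (max (absv x1) (absv y1) * max (absv x2) (absv y2))"
proof -
  obtain s where s: "s \<noteq> 0" "x1 = s * fst (hom_coords (of_hom x1 y1))"
    "y1 = s * snd (hom_coords (of_hom x1 y1))" using of_hom_scale assms(2) by metis
  obtain t where t: "t \<noteq> 0" "x2 = t * fst (hom_coords (of_hom x2 y2))"
    "y2 = t * snd (hom_coords (of_hom x2 y2))" using of_hom_scale assms(3) by metis
  obtain a c a' c' where ac: "hom_coords (of_hom x1 y1) = (a, c)"
    "hom_coords (of_hom x2 y2) = (a', c')" by (meson surj_pair)
  have eqs: "x1 = s * a" "y1 = s * c" "x2 = t * a'" "y2 = t * c'" using s t ac by simp_all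
  have pos: "absv s > 0" "absv t > 0"
    using s t val_abs_nonneg[OF assms(1)] val_abs_eq_0_iff[OF assms(1)]
    by (auto simp: absv_def less_le)
  have mult: "absv (x * y) = absv x * absv y" for x y
    using val_abs_mult[OF assms(1)] by (simp add: absv_def)
  have "x1 * y2 - x2 * y1 = (s * t) * (a * c' - a' * c)" by (simp add: eqs algebra_simps)
  hence n: "absv (x1 * y2 - x2 * y1) = (absv s * absv t) * absv (a * c' - a' * c)"
    by (simp add: mult)
  have m: "max (absv x1) (absv y1) = absv s * max (absv a) (absv c)"
    "max (absv x2) (absv y2) = absv t * max (absv a') (absv c')"
    using pos by (auto simp: eqs mult max_def)
  show ?thesis using pos by (simp add: chordal_def ac n m)
qed

section \<open>Julia sets\<close>

definition equicontinuous_at ::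
  "('c :: field \<Rightarrow> real) \<Rightarrow> ('i \<Rightarrow> 'c proj_line \<Rightarrow> 'c proj_line) \<Rightarrow> 'c proj_line \<Rightarrow> bool" where
  "equicontinuous_at absv F p \<longleftrightarrow>
     (\<forall>\<epsilon>>0. \<exists>\<delta>>0. \<forall>q. chordal absv p q < \<delta> \<longrightarrow> (\<forall>i. chordal absv (F i p) (F i q) < \<epsilon>))"

text \<open>Equicontinuity \<^emph>\<open>around\<close> a point means equicontinuity at all points of a neighbourhood.\<close>

definition julia_set ::
  "('c :: field \<Rightarrow> real) \<Rightarrow> ('c proj_line \<Rightarrow> 'c proj_line) \<Rightarrow> 'c proj_line set" where
  "julia_set absv f =
     {p. \<not> (\<exists>r>0. \<forall>q. chordal absv p q < r \<longrightarrow> equicontinuous_at absv (\<lambda>i :: nat. f ^^ i) q)}"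

fun poly_map :: "'c :: field poly \<Rightarrow> 'c proj_line \<Rightarrow> 'c proj_line" where
  "poly_map f (Aff z) = Aff (poly f z)"
| "poly_map f Infty = (if Polynomial.degree f = 0 then Aff (Polynomial.coeff f 0) else Infty)"

text \<open>
  Here \<open>\<iota>\<close> is the embedding of the field of definition \<open>K\<close> into the ambient field, so that
  \<open>range (map_proj_line \<iota>)\<close> is the set of \<open>K\<close>-rational points of the projective line.
\<close>

definition rational_julia_set ::
  "('c :: field \<Rightarrow> real) \<Rightarrow> ('k :: field \<Rightarrow> 'c) \<Rightarrow> 'k poly \<Rightarrow> 'c proj_line set" where
  "rational_julia_set absv \<iota> \<phi> =
     julia_set absv (poly_map (map_poly \<iota> \<phi>)) \<inter> range (map_proj_line \<iota>)"

definition repelling_fixed_point :: "('c :: field \<Rightarrow> ereal) \<Rightarrow> 'c poly \<Rightarrow> 'c \<Rightarrow> bool" where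
  "repelling_fixed_point u f z \<longleftrightarrow> poly f z = z \<and> u (poly (pderiv f) z) < 0"

end

theory Submission
  imports Defs
begin

text \<open>
  Let \<open>f\<close> be the cubic over \<open>\<complex>\<^sub>v\<close>, with leading coefficient \<open>a\<close> and fixed points \<open>p0, p1, p2\<close>, so
  that \<open>f z - z = a (z - p0) (z - p1) (z - p2)\<close>. The identity
  \<open>f z - p0 = (z - p0) (1 + a (z - p1) (z - p2))\<close> and its analogues for the other fixed points
  describe the dynamics completely enough. Let \<open>R\<close> be the diameter of \<open>{p0, p1, p2}\<close>; by the
  ultrametric inequality it is the larger of the distances from any one of the \<open>pi\<close> to the others.

  If \<open>\<bar>a\<bar> R\<^sup>2 \<le> 1\<close>, then \<open>f\<close> does not increase distances in the disc \<open>\<bar>a\<bar> \<bar>y - p0\<bar>\<^sup>2 \<le> 1\<close>, and all points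
  outside it escape to infinity (\<open>f\<close> has potentially good reduction). Hence the Julia set is empty
  (\<open>julia_set_empty_if_fixed_points_close\<close>).

  If \<open>\<bar>a\<bar> R\<^sup>2 > 1\<close>, then every point at distance more than \<open>R\<close> from \<open>p0\<close> escapes, and a point \<open>x\<close> at
  distance exactly \<open>R\<close> from all three fixed points escapes after one more step, because then
  \<open>\<bar>f x - x\<bar> = \<bar>a\<bar> R\<^sup>3 > R\<close>. Escaping points lie in the Fatou set
  (\<open>escaping_not_in_julia_set\<close>). So a point \<open>x\<close> of the Julia set has all fixed points within
  distance \<open>R\<close> and at least one of them, but not all of them, at distance less than \<open>R\<close>: among the
  distances from \<open>x\<close> to the fixed points, one is separated from the other two, being either strictly
  the smallest or strictly the largest. The corresponding fixed point \<open>q\<close> has distance \<open>R\<close> from the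
  other two, so that its multiplier has absolute value \<open>\<bar>a\<bar> R\<^sup>2 > 1\<close>, and nearby distances to \<open>q\<close> are
  multiplied by this factor; thus \<open>q\<close> is repelling and lies in the Julia set
  (\<open>isolated_fixed_point_repelling\<close>, \<open>isolated_fixed_point_in_julia_set\<close>).

  If moreover \<open>x\<close> is \<open>K\<close>-rational, then the separation says that the Newton polygon of \<open>f z - z\<close>,
  expanded at \<open>x\<close>, has an end segment of length one that belongs to \<open>q\<close>. After rescaling, Hensel's
  lemma produces a root in \<open>K\<close> of this slope, which can only be \<open>q\<close>
  (\<open>isolated_fixed_point_rational\<close>).
\<close>

section \<open>Absolute values of valued fields\<close>

lemma one_divide_less_commute:
  fixes \<epsilon> r :: real
  assumes "\<epsilon> > 0" "1 / \<epsilon> < r"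
  shows "1 / r < \<epsilon>"
proof -
  have "r > 0" using assms by (meson less_trans zero_less_divide_1_iff)
  thus ?thesis using assms by (simp add: field_simps)
qed

locale normalized_valued_field = valued_field v for v :: "'a :: field \<Rightarrow> ereal" +
  fixes b :: real
  assumes base: "b > 1"
begin

abbreviation absv :: "'a \<Rightarrow> real" where
  "absv \<equiv> val_abs b v"

lemmas absv_nonneg [simp] = val_abs_nonneg [OF base]
lemmas absv_eq_0_iff [simp] = val_abs_eq_0_iff [OF base]
lemmas absv_minus [simp] = val_abs_minus [OF base]
lemmas absv_mult = val_abs_mult [OF base]
lemmas absv_add_le_max = val_abs_ultrametric [OF base]

lemma absv_0 [simp]: "absv 0 = 0"
  by simp

lemma absv_pos_iff [simp]: "0 < absv x \<longleftrightarrow> x \<noteq> 0"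
  using absv_nonneg[of x] absv_eq_0_iff[of x] by linarith

lemma absv_1 [simp]: "absv 1 = 1"
  using base by (simp add: val_abs_def val_one)

lemma absv_power: "absv (x ^ n) = absv x ^ n"
  by (induction n) (auto simp: absv_mult)

lemma absv_divide: "absv (x / y) = absv x / absv y"
proof (cases "y = 0")
  case False
  have "absv (x / y) * absv y = absv x"
    using False by (simp add: absv_mult[symmetric])
  with False show ?thesis by (simp add: field_simps)
qed simp

lemma absv_commute: "absv (x - y) = absv (y - x)"
  using absv_minus[of "x - y"] by simp

lemma absv_add_le: "absv x \<le> c \<Longrightarrow> absv y \<le> c \<Longrightarrow> absv (x + y) \<le> c"
  using absv_add_le_max[of x y] by linarith

lemma absv_add_less: "absv x < c \<Longrightarrow> absv y < c \<Longrightarrow> absv (x + y) < c"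
  using absv_add_le_max[of x y] by linarith

lemma absv_diff_le: "absv x \<le> c \<Longrightarrow> absv y \<le> c \<Longrightarrow> absv (x - y) \<le> c"
  using absv_add_le[of x c "- y"] by simp

lemma absv_triangle_le: "absv (x - y) \<le> c \<Longrightarrow> absv (y - z) \<le> c \<Longrightarrow> absv (x - z) \<le> c"
  using absv_add_le[of "x - y" c "y - z"] by simp

lemma absv_triangle_less: "absv (x - y) < c \<Longrightarrow> absv (y - z) < c \<Longrightarrow> absv (x - z) < c"
  using absv_add_less[of "x - y" c "y - z"] by simp

lemma absv_add_eq:
  assumes "absv x < absv y"
  shows "absv (x + y) = absv y"
proof (rule antisym)
  show "absv (x + y) \<le> absv y" using assms by (intro absv_add_le) auto
  show "absv y \<le> absv (x + y)"
    using absv_add_less[of "x + y" "absv y" "- x"] assms by fastforce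
qed

lemma absv_isosceles:
  assumes "absv (x - y) < absv (y - z)"
  shows "absv (x - z) = absv (y - z)"
  using absv_add_eq[OF assms] by simp

lemma absv_less_1_iff: "absv x < 1 \<longleftrightarrow> 0 < v x"
proof (cases "x = 0")
  case True
  thus ?thesis using val_eq_PInf_iff[of x] by simp
next
  case False
  hence "v x \<noteq> \<infinity>" using val_eq_PInf_iff by auto
  thus ?thesis using False base val_not_MInf[of x]
    by (cases "v x") (auto simp: val_abs_def powr_less_cancel_iff[of b _ 0, simplified])
qed

lemma absv_eq_1_iff: "absv x = 1 \<longleftrightarrow> v x = 0"
proof (cases "x = 0")
  case True
  thus ?thesis using val_eq_PInf_iff[of x] by simp
next
  case False
  hence "v x \<noteq> \<infinity>" using val_eq_PInf_iff by auto
  thus ?thesis using False base val_not_MInf[of x]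
    by (cases "v x") (auto simp: val_abs_def powr_eq_one_iff)
qed

lemma absv_le_1_iff: "absv x \<le> 1 \<longleftrightarrow> 0 \<le> v x"
  using absv_less_1_iff[of x] absv_eq_1_iff[of x] by (auto simp: less_eq_real_def order_le_less)

section \<open>Equicontinuity in affine coordinates\<close>

lemma chordal_Aff:
  "chordal absv (Aff x) (Aff y) = absv (x - y) / (max (absv x) 1 * max (absv y) 1)"
  by (simp add: chordal_def)

lemma chordal_Infty [simp]:
  "chordal absv Infty Infty = 0"
  "chordal absv Infty (Aff y) = 1 / max (absv y) 1"
  "chordal absv (Aff y) Infty = 1 / max (absv y) 1"
  by (simp_all add: chordal_def)

lemma chordal_Aff_le: "chordal absv (Aff x) (Aff y) \<le> absv (x - y)"
proof -
  have "1 * 1 \<le> max (absv x) 1 * max (absv y) 1"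
    by (intro mult_mono) auto
  thus ?thesis
    using mult_left_mono[of 1 "max (absv x) 1 * max (absv y) 1" "absv (x - y)"]
    by (simp add: chordal_Aff divide_le_eq)
qed

text \<open>
  The chordal and the affine metric define the same neighbourhoods of an affine point, although
  the chordal distance is much smaller far away from the origin. The radius \<open>\<eta>\<close> must depend on
  \<open>\<bar>z\<bar>\<close>: a point \<open>y\<close> with \<open>\<bar>y\<bar> > max \<bar>z\<bar> 1\<close>, like the point at infinity, has chordal distance
  exactly \<open>1 / max \<bar>z\<bar> 1\<close> from \<open>z\<close>.
\<close>

lemma chordal_ball_affine:
  assumes "\<delta> > 0"
  obtains \<eta> where "\<eta> > 0"
    "\<And>q. chordal absv (Aff z) q < \<eta> \<Longrightarrow> \<exists>y. q = Aff y \<and> absv (y - z) < \<delta>"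
proof
  define M where "M = max (absv z) 1"
  define \<eta> where "\<eta> = min (1 / M) (\<delta> / (M * M))"
  have M: "M \<ge> 1" "absv z \<le> M" by (auto simp: M_def)
  show "\<eta> > 0" using M assms by (simp add: \<eta>_def)
  fix q assume q: "chordal absv (Aff z) q < \<eta>"
  show "\<exists>y. q = Aff y \<and> absv (y - z) < \<delta>"
  proof (cases q)
    case Infty
    thus ?thesis using q by (simp add: \<eta>_def M_def)
  next
    case (Aff y)
    have q': "absv (y - z) / (M * max (absv y) 1) < \<eta>"
      using q by (simp add: Aff chordal_Aff M_def absv_commute)
    have "absv y \<le> M"
    proof (rule ccontr)
      assume "\<not> absv y \<le> M"
      hence y: "absv y > M" by simp
      hence "absv (y - z) = absv y"
        using absv_add_eq[of "- z" y] M by simp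
      moreover have "absv y > 0" using y M by linarith
      ultimately have "1 / M < \<eta>" using q' y M by simp
      thus False by (simp add: \<eta>_def)
    qed
    hence "max (absv y) 1 \<le> M" using M by simp
    hence "absv (y - z) / (M * M) \<le> absv (y - z) / (M * max (absv y) 1)"
      using M by (intro divide_left_mono mult_left_mono mult_pos_pos) auto
    also have "\<dots> < \<delta> / (M * M)" using q' by (simp add: \<eta>_def)
    finally have "absv (y - z) < \<delta>" using M by (simp add: divide_less_cancel)
    thus ?thesis using Aff by simp
  qed
qed

lemma equicontinuous_at_AffI:
  assumes "\<And>\<epsilon>. \<epsilon> > 0 \<Longrightarrow> \<exists>\<delta>>0. \<forall>y. absv (y - z) < \<delta> \<longrightarrow>
             (\<forall>i. chordal absv (F i (Aff z)) (F i (Aff y)) < \<epsilon>)"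
  shows "equicontinuous_at absv F (Aff z)"
  unfolding equicontinuous_at_def
proof (intro allI impI)
  fix \<epsilon> :: real assume "\<epsilon> > 0"
  then obtain \<delta> where \<delta>: "\<delta> > 0" "\<And>y i. absv (y - z) < \<delta> \<Longrightarrow>
    chordal absv (F i (Aff z)) (F i (Aff y)) < \<epsilon>" using assms by blast
  obtain \<eta> where "\<eta> > 0"
    "\<And>q. chordal absv (Aff z) q < \<eta> \<Longrightarrow> \<exists>y. q = Aff y \<and> absv (y - z) < \<delta>"
    using chordal_ball_affine[OF \<delta>(1)] by blast
  thus "\<exists>\<eta>>0. \<forall>q. chordal absv (Aff z) q < \<eta> \<longrightarrow> (\<forall>i. chordal absv (F i (Aff z)) (F i q) < \<epsilon>)"
    using \<delta>(2) by metis
qed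

lemma not_in_julia_set_AffI:
  assumes "r > 0"
    and "\<And>y. absv (y - z) < r \<Longrightarrow> equicontinuous_at absv (\<lambda>i. f ^^ i) (Aff y)"
  shows "Aff z \<notin> julia_set absv f"
proof -
  obtain \<eta> where "\<eta> > 0"
    "\<And>q. chordal absv (Aff z) q < \<eta> \<Longrightarrow> \<exists>y. q = Aff y \<and> absv (y - z) < r"
    using chordal_ball_affine[OF assms(1)] by blast
  thus ?thesis using assms(2) unfolding julia_set_def by blast
qed

lemma poly_map_iterate_Aff: "(poly_map f ^^ i) (Aff z) = Aff ((poly f ^^ i) z)"
  by (induction i) auto

text \<open>
  A Lipschitz bound, rather than mere continuity, keeps the induction over the coefficients to one
  product rule: on the unit disc around \<open>z\<close> it also bounds the values of the polynomial.
\<close>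

lemma poly_locally_lipschitz:
  "\<exists>L\<ge>0. \<forall>y. absv (y - z) \<le> 1 \<longrightarrow> absv (poly f y - poly f z) \<le> L * absv (y - z)"
proof (induction f)
  case 0
  show ?case by (auto intro!: exI[of _ 0])
next
  case (pCons c f)
  then obtain L where L: "L \<ge> 0"
    "\<And>y. absv (y - z) \<le> 1 \<Longrightarrow> absv (poly f y - poly f z) \<le> L * absv (y - z)" by blast
  define M where "M = max (max L (absv (poly f z))) (absv z * L)"
  have M: "L \<le> M" "absv (poly f z) \<le> M" "absv z * L \<le> M" "M \<ge> 0"
    using L(1) by (auto simp: M_def)
  have "absv (poly (pCons c f) y - poly (pCons c f) z) \<le> M * absv (y - z)"
    if y: "absv (y - z) \<le> 1" for y
  proof -
    have "L * absv (y - z) \<le> M * 1" using M y by (intro mult_mono) auto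
    hence "absv (poly f y - poly f z) \<le> M" using L(2)[OF y] by simp
    hence "absv ((poly f y - poly f z) + poly f z) \<le> M"
      using M by (intro absv_add_le) auto
    hence 1: "absv ((y - z) * poly f y) \<le> M * absv (y - z)"
      using mult_right_mono[of "absv (poly f y)" M "absv (y - z)"] by (simp add: absv_mult mult.commute)
    have "absv (z * (poly f y - poly f z)) \<le> absv z * (L * absv (y - z))"
      using L(2)[OF y] by (simp add: absv_mult mult_left_mono)
    also have "\<dots> \<le> M * absv (y - z)"
      using mult_right_mono[OF M(3), of "absv (y - z)"] by (simp add: mult.assoc)
    finally have 2: "absv (z * (poly f y - poly f z)) \<le> M * absv (y - z)" .
    have "poly (pCons c f) y - poly (pCons c f) z = (y - z) * poly f y + z * (poly f y - poly f z)"
      by (simp add: algebra_simps)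
    thus ?thesis using absv_add_le[OF 1 2] by simp
  qed
  thus ?case using M by blast
qed

lemma poly_iterate_continuous:
  assumes "\<epsilon> > 0"
  shows "\<exists>\<delta>>0. \<forall>y. absv (y - z) < \<delta> \<longrightarrow> absv ((poly f ^^ i) y - (poly f ^^ i) z) < \<epsilon>"
  using assms
proof (induction i arbitrary: \<epsilon>)
  case 0
  thus ?case by auto
next
  case (Suc i)
  define s where "s = (poly f ^^ i) z"
  obtain L where L: "L \<ge> 0"
    "\<And>y. absv (y - s) \<le> 1 \<Longrightarrow> absv (poly f y - poly f s) \<le> L * absv (y - s)"
    using poly_locally_lipschitz by blast
  have "min 1 (\<epsilon> / (L + 1)) > 0" using L(1) Suc.prems by simp
  then obtain \<delta> where \<delta>: "\<delta> > 0"
    "\<And>y. absv (y - z) < \<delta> \<Longrightarrow> absv ((poly f ^^ i) y - s) < min 1 (\<epsilon> / (L + 1))"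
    using Suc.IH unfolding s_def by blast
  have "absv ((poly f ^^ Suc i) y - (poly f ^^ Suc i) z) < \<epsilon>" if "absv (y - z) < \<delta>" for y
  proof -
    define t where "t = (poly f ^^ i) y"
    have t: "absv (t - s) < 1" "absv (t - s) < \<epsilon> / (L + 1)"
      using \<delta>(2)[OF that] by (auto simp: t_def)
    have "absv (poly f t - poly f s) \<le> L * absv (t - s)" using L(2) t by simp
    also have "\<dots> \<le> (L + 1) * absv (t - s)" by (intro mult_right_mono) auto
    also have "\<dots> < \<epsilon>" using t(2) L(1) by (simp add: field_simps)
    finally show ?thesis by (simp add: t_def s_def)
  qed
  thus ?case using \<delta>(1) by blast
qed

lemma poly_iterates_equicontinuous_finite:
  assumes "\<epsilon> > 0"
  shows "\<exists>\<delta>>0. \<forall>y. absv (y - z) < \<delta> \<longrightarrow>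
           (\<forall>i\<le>N. absv ((poly f ^^ i) y - (poly f ^^ i) z) < \<epsilon>)"
proof (induction N)
  case 0
  show ?case using assms by auto
next
  case (Suc N)
  then obtain \<delta>1 where \<delta>1: "\<delta>1 > 0" "\<And>y i. absv (y - z) < \<delta>1 \<Longrightarrow> i \<le> N \<Longrightarrow>
    absv ((poly f ^^ i) y - (poly f ^^ i) z) < \<epsilon>" by blast
  obtain \<delta>2 where \<delta>2: "\<delta>2 > 0" "\<And>y. absv (y - z) < \<delta>2 \<Longrightarrow>
    absv ((poly f ^^ Suc N) y - (poly f ^^ Suc N) z) < \<epsilon>"
    using poly_iterate_continuous[OF assms] by blast
  show ?case
  proof (intro exI[of _ "min \<delta>1 \<delta>2"] conjI allI impI)
    fix y i assume y: "absv (y - z) < min \<delta>1 \<delta>2" and "i \<le> Suc N"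
    thus "absv ((poly f ^^ i) y - (poly f ^^ i) z) < \<epsilon>"
      using \<delta>1(2)[of y i] \<delta>2(2)[of y] by (cases "i = Suc N") (auto simp del: funpow.simps)
  qed (use \<delta>1 \<delta>2 in auto)
qed

text \<open>
  Points arbitrarily close to \<open>p\<close> are driven out of the disc of radius \<open>R\<close> by the factor \<open>c\<close>, while
  \<open>p\<close> stays fixed. Such points exist only if the valuation is nontrivial, which is what the last
  hypothesis expresses.
\<close>

lemma expanding_fixed_point_in_julia_set:
  assumes "R > 0" "c > 1" "poly f p = p"
    and expand: "\<And>y. absv (y - p) < R \<Longrightarrow> absv (poly f y - p) = c * absv (y - p)"
    and nontrivial: "\<And>\<delta>. \<delta> > 0 \<Longrightarrow> \<exists>h. 0 < absv h \<and> absv h < \<delta>"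
  shows "Aff p \<in> julia_set absv (poly_map f)"
proof (rule ccontr)
  assume "Aff p \<notin> julia_set absv (poly_map f)"
  then obtain r where "r > 0" "\<And>q. chordal absv (Aff p) q < r \<Longrightarrow>
      equicontinuous_at absv (\<lambda>i. poly_map f ^^ i) q" unfolding julia_set_def by blast
  hence eq: "equicontinuous_at absv (\<lambda>i. poly_map f ^^ i) (Aff p)" by (simp add: chordal_Aff)
  have fixed: "(poly f ^^ i) p = p" for i by (induction i) (auto simp: assms)
  obtain \<eta> where \<eta>: "\<eta> > 0"
    "\<And>q. chordal absv (Aff p) q < \<eta> \<Longrightarrow> \<exists>y. q = Aff y \<and> absv (y - p) < R"
    using chordal_ball_affine[OF assms(1)] by blast
  then obtain \<delta> where \<delta>: "\<delta> > 0" "\<And>q i. chordal absv (Aff p) q < \<delta> \<Longrightarrow>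
      chordal absv ((poly_map f ^^ i) (Aff p)) ((poly_map f ^^ i) q) < \<eta>"
    using eq unfolding equicontinuous_at_def by blast
  obtain h where h: "0 < absv h" "absv h < \<delta>" using nontrivial \<delta>(1) by blast
  have "chordal absv (Aff p) (Aff (p + h)) < \<delta>"
    using chordal_Aff_le[of p "p + h"] h by simp
  hence near: "absv ((poly f ^^ i) (p + h) - p) < R" for i
    using \<eta>(2)[of "Aff ((poly f ^^ i) (p + h))"] \<delta>(2)[of "Aff (p + h)" i]
    by (simp add: poly_map_iterate_Aff fixed)
  have grow: "absv ((poly f ^^ i) (p + h) - p) = c ^ i * absv h" for i
    by (induction i) (auto simp: expand[OF near])
  obtain n where "R / absv h < c ^ n" using real_arch_pow[OF assms(2)] by blast
  hence "R < c ^ n * absv h" using h(1) by (simp add: field_simps)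
  thus False using near[of n] grow[of n] by simp
qed

end

section \<open>Cubic polynomials with given fixed points\<close>

locale cubic_with_fixed_points = normalized_valued_field u b
  for u :: "'c :: field \<Rightarrow> ereal" and b :: real +
  fixes f :: "'c poly" and a p0 p1 p2 :: 'c
  assumes a_nonzero: "a \<noteq> 0"
    and f_eq: "f = [:0, 1:] + Polynomial.smult a ([:- p0, 1:] * [:- p1, 1:] * [:- p2, 1:])"
begin

lemma poly_f: "poly f z = z + a * ((z - p0) * (z - p1) * (z - p2))"
  by (simp add: f_eq algebra_simps)

lemma degree_f: "Polynomial.degree f = 3"
  using a_nonzero by (simp add: f_eq)

lemma multiplier_p0: "poly (pderiv f) p0 = 1 + a * (p0 - p1) * (p0 - p2)"
  by (simp add: f_eq pderiv_add pderiv_smult pderiv_mult pderiv_pCons algebra_simps)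

text \<open>
  When \<open>\<bar>a (z - p1) (z - p2)\<bar> > 1\<close>, the term \<open>1\<close> in \<open>f z - p0 = (z - p0) (1 + a (z - p1) (z - p2))\<close>
  is dominated. This exact formula governs both the escape to infinity and the repulsion from
  \<open>p0\<close>.
\<close>

lemma expansion_from_p0:
  assumes "1 < absv a * absv (z - p1) * absv (z - p2)"
  shows "absv (poly f z - p0) = absv a * absv (z - p1) * absv (z - p2) * absv (z - p0)"
proof -
  have "absv (1 + a * (z - p1) * (z - p2)) = absv (a * (z - p1) * (z - p2))"
    using assms by (intro absv_add_eq) (simp add: absv_mult)
  moreover have "poly f z - p0 = (1 + a * (z - p1) * (z - p2)) * (z - p0)"
    by (simp add: poly_f algebra_simps)
  ultimately show ?thesis by (simp add: absv_mult)
qed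

text \<open>
  In this region the three fixed points look equally distant, and \<open>f\<close> acts on the distance to
  \<open>p0\<close> by \<open>r \<mapsto> \<bar>a\<bar> r\<^sup>3 > r\<close>. The condition depends only on \<open>\<bar>z - p0\<bar>\<close>, and it passes to larger
  distances.
\<close>

definition far :: "'c \<Rightarrow> bool" where
  "far z \<longleftrightarrow> absv (p1 - p0) < absv (z - p0) \<and> absv (p2 - p0) < absv (z - p0) \<and>
             1 < absv a * absv (z - p0) ^ 2"

lemma far_expansion:
  assumes "far z"
  shows "absv (poly f z - p0) = absv a * absv (z - p0) ^ 2 * absv (z - p0)"
proof -
  have "absv (z - p1) = absv (z - p0)" "absv (z - p2) = absv (z - p0)"
    using absv_add_eq[of "p0 - p1" "z - p0"] absv_add_eq[of "p0 - p2" "z - p0"] assms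
    by (auto simp: far_def absv_commute[of p0])
  thus ?thesis
    using expansion_from_p0[of z] assms by (simp add: far_def power2_eq_square mult.assoc)
qed

lemma far_mono:
  assumes "far z" "absv (z - p0) \<le> absv (y - p0)"
  shows "far y"
proof -
  have "absv a * absv (z - p0) ^ 2 \<le> absv a * absv (y - p0) ^ 2"
    using assms(2) by (intro mult_left_mono power_mono) auto
  thus ?thesis using assms unfolding far_def by linarith
qed

text \<open>
  The growth factor \<open>\<bar>a\<bar> r\<^sup>2\<close> increases with \<open>r\<close>, so that its initial value bounds it from below
  along the whole orbit.
\<close>

lemma far_iterates:
  assumes "far z"
  shows "far ((poly f ^^ i) z)"
    and "(absv a * absv (z - p0) ^ 2) ^ i * absv (z - p0) \<le> absv ((poly f ^^ i) z - p0)"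
proof -
  define c where "c = absv a * absv (z - p0) ^ 2"
  have c: "c > 1" using assms by (simp add: c_def far_def)
  have "far ((poly f ^^ i) z) \<and> c ^ i * absv (z - p0) \<le> absv ((poly f ^^ i) z - p0)"
  proof (induction i)
    case 0
    show ?case using assms by simp
  next
    case (Suc i)
    define y where "y = (poly f ^^ i) z"
    have y: "far y" "c ^ i * absv (z - p0) \<le> absv (y - p0)" using Suc by (auto simp: y_def)
    have "1 * absv (z - p0) \<le> c ^ i * absv (z - p0)"
      using c by (intro mult_right_mono one_le_power) auto
    hence "absv (z - p0) \<le> absv (y - p0)" using y(2) by simp
    hence "c \<le> absv a * absv (y - p0) ^ 2"
      unfolding c_def by (intro mult_left_mono power_mono) auto
    hence "c * (c ^ i * absv (z - p0)) \<le> absv a * absv (y - p0) ^ 2 * absv (y - p0)"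
      using y(2) c by (intro mult_mono) auto
    hence grow: "c * (c ^ i * absv (z - p0)) \<le> absv (poly f y - p0)"
      using far_expansion[OF y(1)] by simp
    have "1 * absv (y - p0) \<le> absv (poly f y - p0)"
      using y(1) unfolding far_expansion[OF y(1)]
      by (intro mult_right_mono) (auto simp: far_def)
    hence "far (poly f y)" using far_mono[OF y(1)] by simp
    with grow show ?case by (simp add: y_def mult.assoc)
  qed
  thus "far ((poly f ^^ i) z)"
    and "(absv a * absv (z - p0) ^ 2) ^ i * absv (z - p0) \<le> absv ((poly f ^^ i) z - p0)"
    by (auto simp: c_def)
qed

lemma far_iterates_ge:
  assumes "far z"
  shows "absv (z - p0) \<le> absv ((poly f ^^ i) z - p0)"
proof -
  have "1 * absv (z - p0) \<le> (absv a * absv (z - p0) ^ 2) ^ i * absv (z - p0)"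
    using assms by (intro mult_right_mono one_le_power) (auto simp: far_def)
  thus ?thesis using far_iterates(2)[OF assms, of i] by linarith
qed

lemma far_iterates_unbounded:
  assumes "far z"
  obtains N where "\<And>i. i \<ge> N \<Longrightarrow> T < absv ((poly f ^^ i) z - p0)"
proof -
  define c where "c = absv a * absv (z - p0) ^ 2"
  have c: "c > 1" and z: "absv (z - p0) > 0"
    using assms by (auto simp: c_def far_def intro: le_less_trans[OF absv_nonneg])
  obtain N where N: "T / absv (z - p0) < c ^ N" using real_arch_pow[OF c] by blast
  show ?thesis
  proof
    fix i assume "i \<ge> N"
    have "T < c ^ N * absv (z - p0)" using N z by (simp add: field_simps)
    also have "\<dots> \<le> c ^ i * absv (z - p0)"
      using c \<open>i \<ge> N\<close> by (intro mult_right_mono power_increasing) auto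
    also have "\<dots> \<le> absv ((poly f ^^ i) z - p0)" using far_iterates(2)[OF assms] by (simp add: c_def)
    finally show "T < absv ((poly f ^^ i) z - p0)" .
  qed
qed

lemma far_iterates_cong:
  assumes "far z" "absv (y - p0) = absv (z - p0)"
  shows "absv ((poly f ^^ i) y - p0) = absv ((poly f ^^ i) z - p0)"
proof (induction i)
  case (Suc i)
  have "far y" using far_mono assms by simp
  thus ?case
    using Suc far_expansion far_iterates(1) assms(1) by simp
qed (use assms in simp)

text \<open>
  By the ultrametric inequality, all points near an escaping point have, after \<open>n\<close> steps, exactly
  the same distance to \<open>p0\<close>, and keep the same distances forever (\<open>far_iterates_cong\<close>). Hence
  they tend to infinity simultaneously, and points close to infinity are chordally close to each
  other. Only finitely many iterates remain, and these are continuous.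
\<close>

lemma equicontinuous_at_escaping:
  assumes "far ((poly f ^^ n) z)"
  shows "equicontinuous_at absv (\<lambda>i. poly_map f ^^ i) (Aff z)"
proof (rule equicontinuous_at_AffI)
  fix \<epsilon> :: real assume \<epsilon>: "\<epsilon> > 0"
  define zn where "zn = (poly f ^^ n) z"
  have zn: "far zn" "absv (zn - p0) > 0"
    using assms by (auto simp: zn_def far_def intro: le_less_trans[OF absv_nonneg])
  obtain N where N: "\<And>i. i \<ge> N \<Longrightarrow> max (absv p0) (max 1 (1 / \<epsilon>)) < absv ((poly f ^^ i) zn - p0)"
    using far_iterates_unbounded[OF zn(1)] by blast
  obtain \<delta> where \<delta>: "\<delta> > 0" "\<And>y i. absv (y - z) < \<delta> \<Longrightarrow> i \<le> N + n \<Longrightarrow>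
      absv ((poly f ^^ i) y - (poly f ^^ i) z) < min \<epsilon> (absv (zn - p0))"
    using poly_iterates_equicontinuous_finite[of "min \<epsilon> (absv (zn - p0))" z "N + n" f] \<epsilon> zn(2)
    by (auto simp del: min_less_iff_conj simp: min_less_iff_conj[of 0])
  have "chordal absv ((poly_map f ^^ i) (Aff z)) ((poly_map f ^^ i) (Aff y)) < \<epsilon>"
    if y: "absv (y - z) < \<delta>" for y i
  proof (cases "i \<le> N + n")
    case True
    have "absv ((poly f ^^ i) z - (poly f ^^ i) y) < \<epsilon>"
      using \<delta>(2)[OF y True] by (simp add: absv_commute)
    thus ?thesis using chordal_Aff_le le_less_trans by (simp add: poly_map_iterate_Aff) blast
  next
    case False
    define k where "k = i - n"
    have k: "i = k + n" "k \<ge> N" using False by (auto simp: k_def)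
    define yn where "yn = (poly f ^^ n) y"
    define s where "s = (poly f ^^ i) z"
    define t where "t = (poly f ^^ i) y"
    have st: "s = (poly f ^^ k) zn" "t = (poly f ^^ k) yn"
      by (simp_all add: s_def t_def zn_def yn_def k funpow_add)
    have "absv (yn - zn) < absv (zn - p0)" using \<delta>(2)[OF y, of n] by (simp add: yn_def zn_def)
    hence "absv (yn - p0) = absv (zn - p0)" by (rule absv_isosceles)
    hence eq: "absv (t - p0) = absv (s - p0)" unfolding st by (rule far_iterates_cong[OF zn(1)])
    have big: "absv p0 < absv (s - p0)" "1 < absv (s - p0)" "1 / \<epsilon> < absv (s - p0)"
      using N[OF k(2)] by (auto simp: st)
    have s: "absv s = absv (s - p0)" using absv_add_eq[of p0 "s - p0"] big by simp
    have t: "absv t = absv (s - p0)" using absv_add_eq[of p0 "t - p0"] big eq by simp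
    have "absv (s - t) \<le> absv (s - p0)" using s t by (intro absv_diff_le) auto
    hence "absv (s - t) / (absv s * absv t) \<le> absv s / (absv s * absv t)"
      using s by (intro divide_right_mono) auto
    hence "chordal absv (Aff s) (Aff t) \<le> 1 / absv s"
      using s t big by (simp add: chordal_Aff max_def split: if_splits)
    also have "\<dots> < \<epsilon>" using one_divide_less_commute big \<epsilon> s by simp
    finally show ?thesis by (simp add: poly_map_iterate_Aff s_def t_def)
  qed
  thus "\<exists>\<delta>>0. \<forall>y. absv (y - z) < \<delta> \<longrightarrow>
      (\<forall>i. chordal absv ((poly_map f ^^ i) (Aff z)) ((poly_map f ^^ i) (Aff y)) < \<epsilon>)"
    using \<delta>(1) by blast
qed

lemma escaping_not_in_julia_set:
  assumes "far ((poly f ^^ n) z)"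
  shows "Aff z \<notin> julia_set absv (poly_map f)"
proof -
  define zn where "zn = (poly f ^^ n) z"
  have zn: "far zn" "absv (zn - p0) > 0"
    using assms by (auto simp: zn_def far_def intro: le_less_trans[OF absv_nonneg])
  obtain \<delta> where \<delta>: "\<delta> > 0" "\<And>y. absv (y - z) < \<delta> \<Longrightarrow>
      absv ((poly f ^^ n) y - zn) < absv (zn - p0)"
    using poly_iterate_continuous[OF zn(2)] unfolding zn_def by blast
  have "far ((poly f ^^ n) y)" if "absv (y - z) < \<delta>" for y
    using far_mono[OF zn(1)] absv_isosceles[OF \<delta>(2)[OF that]] by simp
  thus ?thesis using not_in_julia_set_AffI[OF \<delta>(1)] equicontinuous_at_escaping by blast
qed

text \<open>
  Infinity is a superattracting fixed point: as soon as \<open>\<bar>y\<bar>\<close> exceeds all the constants of \<open>f\<close>, the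
  orbit of \<open>y\<close> never gets closer to the origin again.
\<close>

lemma Infty_not_in_julia_set: "Infty \<notin> julia_set absv (poly_map f)"
proof -
  have iter: "(poly_map f ^^ i) Infty = Infty" for i
    by (induction i) (simp_all add: degree_f)
  obtain c :: real where c: "c \<ge> 1" "absv p0 \<le> c" "absv p1 \<le> c" "absv p2 \<le> c" "1 / absv a \<le> c"
    by (rule that[of "max (1 / absv a) (max 1 (max (absv p0) (max (absv p1) (absv p2))))"]) auto
  have far: "far y" "absv (y - p0) = absv y" if "c < absv y" for y
  proof -
    show y: "absv (y - p0) = absv y"
      using absv_add_eq[of "- p0" y] that c by simp
    have "1 \<le> absv a * c" using c(5) a_nonzero by (simp add: field_simps)
    moreover have "absv a * c < absv a * absv y" using that a_nonzero by simp
    ultimately have "1 < absv a * absv y" by linarith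
    moreover have "absv (p1 - p0) \<le> c" "absv (p2 - p0) \<le> c" using c by (auto intro: absv_diff_le)
    moreover have "absv a * absv y * 1 \<le> absv a * absv y * absv y"
      using that c(1) by (intro mult_left_mono) auto
    ultimately show "far y" using that by (simp add: far_def y power2_eq_square)
  qed
  have near: "c < absv y" if "chordal absv Infty (Aff y) < 1 / c" "c \<ge> 1" for c y
  proof -
    have "c < max (absv y) 1"
      using that by (simp add: field_simps del: less_max_iff_disj)
    thus ?thesis using that(2) by auto
  qed
  have "equicontinuous_at absv (\<lambda>i. poly_map f ^^ i) q" if q: "chordal absv Infty q < 1 / c" for q
  proof (cases q)
    case (Aff y)
    hence "far y" using far near c q by blast
    thus ?thesis using equicontinuous_at_escaping[of 0] Aff by simp
  next
    case Infty
    show ?thesis unfolding equicontinuous_at_def Infty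
    proof (intro allI impI)
      fix \<epsilon> :: real assume \<epsilon>: "\<epsilon> > 0"
      define d where "d = max c (1 / \<epsilon>)"
      have d: "d \<ge> c" "d \<ge> 1 / \<epsilon>" "d > 0" using c by (auto simp: d_def)
      have "chordal absv ((poly_map f ^^ i) Infty) ((poly_map f ^^ i) q) < \<epsilon>"
        if q: "chordal absv Infty q < 1 / d" for q i
      proof (cases q)
        case Infty
        thus ?thesis using \<epsilon> by (simp add: iter)
      next
        case (Aff y)
        define t where "t = (poly f ^^ i) y"
        have y: "d < absv y" using near q d c Aff by (metis order_trans)
        have "absv y \<le> absv (t - p0)"
          using far_iterates_ge[of y i] far[of y] y d by (simp add: t_def)
        moreover from this have "absv t = absv (t - p0)"
          using absv_add_eq[of p0 "t - p0"] y d c by simp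
        ultimately have "d < absv t" using y by simp
        hence t: "1 / \<epsilon> < absv t" "1 < absv t" using d c by auto
        hence "1 / max (absv t) 1 < \<epsilon>"
          using one_divide_less_commute[OF \<epsilon> t(1)] by (simp add: max_def)
        thus ?thesis by (simp add: iter Aff poly_map_iterate_Aff t_def)
      qed
      thus "\<exists>\<delta>>0. \<forall>q. chordal absv Infty q < \<delta> \<longrightarrow>
          (\<forall>i. chordal absv ((poly_map f ^^ i) Infty) ((poly_map f ^^ i) q) < \<epsilon>)"
        using d(3) by (intro exI[of _ "1 / d"]) (auto simp del: chordal_Infty)
    qed
  qed
  thus ?thesis using c unfolding julia_set_def by (force simp del: chordal_Infty intro!: exI[of _ "1 / c"])
qed

text \<open>
  On the disc \<open>D\<close> of radius \<open>S = \<bar>a\<bar>\<^bsup>-1/2\<^esup>\<close> around \<open>p0\<close>, which contains all three fixed points,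
  the difference quotient of \<open>f\<close> is a sum of terms of absolute value at most \<open>1\<close>. So \<open>f\<close> is
  non-expanding on \<open>D\<close> and maps \<open>D\<close> into itself, while the complement of \<open>D\<close> consists of escaping
  points.
\<close>

lemma julia_set_empty_if_fixed_points_close:
  assumes "absv a * absv (p1 - p0) ^ 2 \<le> 1" "absv a * absv (p2 - p0) ^ 2 \<le> 1"
  shows "julia_set absv (poly_map f) = {}"
proof -
  define S where "S = 1 / sqrt (absv a)"
  have S: "S > 0" "absv a * (S * S) = 1"
    using a_nonzero by (auto simp: S_def)
  have le_S: "absv x \<le> S \<longleftrightarrow> absv a * absv x ^ 2 \<le> 1" for x
  proof -
    have "absv x \<le> S \<longleftrightarrow> absv x ^ 2 \<le> S ^ 2" using S by (simp add: power_mono_iff)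
    also have "\<dots> \<longleftrightarrow> absv a * absv x ^ 2 \<le> absv a * S ^ 2" using a_nonzero by simp
    finally show ?thesis using S by (simp add: power2_eq_square)
  qed
  define D where "D = {y. absv (y - p0) \<le> S}"
  have p: "absv (p0 - p0) \<le> S" "absv (p1 - p0) \<le> S" "absv (p2 - p0) \<le> S"
    using assms S by (auto simp: le_S)
  have D: "absv (y - p0) \<le> S" "absv (y - p1) \<le> S" "absv (y - p2) \<le> S" if "y \<in> D" for y
    using that p absv_triangle_le[of y p0 S] by (auto simp: D_def absv_commute[of p0])
  have bound: "absv (a * (s * t)) \<le> 1" if "absv s \<le> S" "absv t \<le> S" for s t
  proof -
    have "absv a * (absv s * absv t) \<le> absv a * (S * S)"
      using that S by (intro mult_left_mono mult_mono) auto
    thus ?thesis using S by (simp add: absv_mult)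
  qed
  have contr: "absv (poly f y - poly f z) \<le> absv (y - z)" if "y \<in> D" "z \<in> D" for y z
  proof -
    have "poly f y - poly f z = (y - z) * (1 + (a * ((y - p1) * (y - p2)) +
        (a * ((z - p0) * (y - p2)) + a * ((z - p0) * (z - p1)))))"
      by (simp add: poly_f algebra_simps)
    moreover have "absv (1 + (a * ((y - p1) * (y - p2)) +
        (a * ((z - p0) * (y - p2)) + a * ((z - p0) * (z - p1))))) \<le> 1"
      using D that by (intro absv_add_le bound) auto
    ultimately show ?thesis using mult_left_mono[of _ 1 "absv (y - z)"] by (simp add: absv_mult)
  qed
  have fixed: "poly f p0 = p0" and p0: "p0 \<in> D" using S by (auto simp: poly_f D_def)
  have inv: "(poly f ^^ i) y \<in> D" if "y \<in> D" for y i
  proof (induction i)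
    case (Suc i)
    thus ?case using contr[OF Suc p0] by (simp add: fixed D_def)
  qed (use that in simp)
  have nonexp: "absv ((poly f ^^ i) y - (poly f ^^ i) z) \<le> absv (y - z)"
    if "y \<in> D" "z \<in> D" for y z i
  proof (induction i)
    case (Suc i)
    thus ?case using contr[OF inv[OF that(1)] inv[OF that(2)], of i i] by simp
  qed simp
  have near: "y \<in> D" if "z \<in> D" "absv (y - z) < S" for y z
    using that absv_triangle_le[of y z S p0] by (auto simp: D_def)
  have "Aff z \<notin> julia_set absv (poly_map f)" for z
  proof (cases "z \<in> D")
    case True
    have "equicontinuous_at absv (\<lambda>i. poly_map f ^^ i) (Aff y)" if "absv (y - z) < S" for y
    proof (rule equicontinuous_at_AffI)
      fix \<epsilon> :: real assume "\<epsilon> > 0"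
      have y: "y \<in> D" using near True that by simp
      have "chordal absv (Aff ((poly f ^^ i) y)) (Aff ((poly f ^^ i) x)) < \<epsilon>"
        if x: "absv (x - y) < min S \<epsilon>" for x i
      proof -
        have "x \<in> D" using near y x by simp
        from nonexp[OF y this, of i] show ?thesis
          using chordal_Aff_le[of "(poly f ^^ i) y" "(poly f ^^ i) x"] x
          by (simp add: absv_commute[of y])
      qed
      thus "\<exists>\<delta>>0. \<forall>x. absv (x - y) < \<delta> \<longrightarrow>
          (\<forall>i. chordal absv ((poly_map f ^^ i) (Aff y)) ((poly_map f ^^ i) (Aff x)) < \<epsilon>)"
        using S \<open>\<epsilon> > 0\<close> by (intro exI[of _ "min S \<epsilon>"]) (auto simp: poly_map_iterate_Aff)
    qed
    thus ?thesis using not_in_julia_set_AffI S by blast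
  next
    case False
    hence "far z" using p(2,3) le_S[of "z - p0"] by (auto simp: far_def D_def)
    thus ?thesis using escaping_not_in_julia_set[of 0] by simp
  qed
  thus ?thesis using Infty_not_in_julia_set by (metis equals0I proj_line.exhaust)
qed

text \<open>
  The multiplier at \<open>p0\<close> is \<open>1 + a (p0 - p1) (p0 - p2)\<close>, in which the second summand dominates.
\<close>

lemma isolated_fixed_point_repelling:
  assumes "absv (p0 - p1) = R" "absv (p0 - p2) = R" "1 < absv a * R ^ 2"
  shows "repelling_fixed_point u f p0"
proof -
  have "absv (a * (p0 - p1) * (p0 - p2)) = absv a * R ^ 2"
    using assms by (simp add: absv_mult power2_eq_square)
  hence "absv (poly (pderiv f) p0) > 1"
    using absv_add_eq[of 1 "a * (p0 - p1) * (p0 - p2)"] assms by (simp add: multiplier_p0)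
  hence "u (poly (pderiv f) p0) < 0" by (simp add: not_le[symmetric] absv_le_1_iff)
  thus ?thesis by (simp add: repelling_fixed_point_def poly_f)
qed

text \<open>
  On the open disc of radius \<open>R\<close> around \<open>p0\<close> the distances to \<open>p1\<close> and \<open>p2\<close> are constantly \<open>R\<close>, so
  that \<open>f\<close> stretches the distance to \<open>p0\<close> by exactly \<open>\<bar>a\<bar> R\<^sup>2\<close>.
\<close>

lemma isolated_fixed_point_in_julia_set:
  assumes "absv (p0 - p1) = R" "absv (p0 - p2) = R" "1 < absv a * R ^ 2"
    and "\<And>\<delta>. \<delta> > 0 \<Longrightarrow> \<exists>h. 0 < absv h \<and> absv h < \<delta>"
  shows "Aff p0 \<in> julia_set absv (poly_map f)"
proof (rule expanding_fixed_point_in_julia_set)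
  have "R \<ge> 0" "R \<noteq> 0" using assms by auto
  thus "R > 0" by simp
  show "1 < absv a * R ^ 2" by fact
  show "poly f p0 = p0" by (simp add: poly_f)
  fix y assume y: "absv (y - p0) < R"
  have "absv (y - p1) = R" "absv (y - p2) = R"
    using absv_isosceles[of y p0] y assms by auto
  thus "absv (poly f y - p0) = absv a * R ^ 2 * absv (y - p0)"
    using expansion_from_p0[of y] assms(3) by (simp add: power2_eq_square mult.assoc)
qed (use assms(4) in blast)

end

section \<open>Isolated roots of cubic polynomials over a henselian field\<close>

locale normalized_henselian_field = henselian_discrete_field v + normalized_valued_field v b
  for v :: "'a :: field \<Rightarrow> ereal" and b :: real
begin

lemma small_elements_exist:
  assumes "\<delta> > 0"
  shows "\<exists>h. 0 < absv h \<and> absv h < \<delta>"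
proof -
  have "ereal (real_of_int 1) \<in> v ` (UNIV - {0})" unfolding value_group by (rule rangeI)
  then obtain \<pi> where "ereal (real_of_int 1) = v \<pi>" "\<pi> \<in> UNIV - {0}" by (rule imageE)
  hence \<pi>: "\<pi> \<noteq> 0" "v \<pi> = 1" by (simp_all add: one_ereal_def)
  hence "absv \<pi> < 1" by (simp add: absv_less_1_iff)
  then obtain n where "absv \<pi> ^ n < \<delta>" using real_arch_pow_inv[OF assms] by blast
  thus ?thesis using \<pi> by (intro exI[of _ "\<pi> ^ n"]) (simp add: absv_power)
qed

text \<open>
  The hypotheses say that the points of the Newton polygon belonging to \<open>c2\<close> and \<open>c3\<close> lie strictly
  above the line through those of \<open>c0\<close> and \<open>c1\<close>, so that exactly one root has the size
  \<open>\<bar>c0 / c1\<bar>\<close>. The substitution \<open>z = (c0 / c1) y\<close> turns the cubic into \<open>c0\<close> times a polynomial that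
  is congruent to \<open>1 + y\<close> modulo the maximal ideal and has the simple root \<open>-1\<close> there.
\<close>

lemma cubic_has_isolated_small_root:
  assumes "absv (c0 * c2) < absv c1 ^ 2" "absv (c0 ^ 2 * c3) < absv c1 ^ 3"
  shows "\<exists>z. c0 + c1 * z + c2 * z ^ 2 + c3 * z ^ 3 = 0 \<and> absv c1 * absv z = absv c0"
proof -
  have c1: "c1 \<noteq> 0" using assms(1) absv_nonneg[of "c0 * c2"] by force
  define A where "A = c0 * c2 / c1 ^ 2"
  define B where "B = c0 ^ 2 * c3 / c1 ^ 3"
  have AB: "absv A < 1" "absv B < 1"
    using assms c1 by (simp_all add: A_def B_def absv_divide absv_power)
  define F where "F = [:1, 1, A, B:]"
  have coeffs: "0 \<le> v (Polynomial.coeff F i)" for i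
    unfolding absv_le_1_iff[symmetric] F_def
    using AB by (auto simp: coeff_pCons split: nat.split)
  have "poly F (-1) = A - B" by (simp add: F_def)
  hence root: "0 < v (poly F (-1))"
    unfolding absv_less_1_iff[symmetric] using absv_add_less[of A 1 "- B"] AB by simp
  have "poly (pderiv F) (-1) = ((B + (B + B)) - (A + A)) + 1"
    by (simp add: F_def pderiv_pCons algebra_simps)
  moreover have "absv ((B + (B + B)) - (A + A)) < 1"
    using AB unfolding diff_conv_add_uminus by (intro absv_add_less) (simp_all only: absv_minus absv_add_less)
  ultimately have simple: "v (poly (pderiv F) (-1)) = 0"
    unfolding absv_eq_1_iff[symmetric] using absv_add_eq[of _ 1] by simp
  have "0 \<le> v (-1)" unfolding absv_le_1_iff[symmetric] by simp
  from hensel[OF coeffs this root simple]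
  obtain y where y: "poly F y = 0" "absv (y + 1) < 1" by (auto simp: absv_less_1_iff)
  have "absv y = 1" using absv_add_eq[of "y + 1" "-1"] y(2) by simp
  moreover have "c0 + c1 * (c0 / c1 * y) + c2 * (c0 / c1 * y) ^ 2 + c3 * (c0 / c1 * y) ^ 3
      = c0 * poly F y"
    using c1 by (simp add: F_def A_def B_def field_simps power2_eq_square power3_eq_cube)
  ultimately show ?thesis
    using y(1) c1 by (intro exI[of _ "c0 / c1 * y"]) (simp add: absv_mult absv_divide)
qed

text \<open>
  Replacing \<open>z\<close> by \<open>1 / z\<close> reverses the coefficients and exchanges the two ends of the Newton
  polygon.
\<close>

lemma cubic_has_isolated_large_root:
  assumes "absv (c3 * c1) < absv c2 ^ 2" "absv (c3 ^ 2 * c0) < absv c2 ^ 3" "c3 \<noteq> 0"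
  shows "\<exists>z. c0 + c1 * z + c2 * z ^ 2 + c3 * z ^ 3 = 0 \<and> absv c3 * absv z = absv c2"
proof -
  obtain w where w: "c3 + c2 * w + c1 * w ^ 2 + c0 * w ^ 3 = 0" "absv c2 * absv w = absv c3"
    using cubic_has_isolated_small_root[OF assms(1,2)] by blast
  have w0: "w \<noteq> 0" using w(2) assms(3) by auto
  have "c0 + c1 * (1 / w) + c2 * (1 / w) ^ 2 + c3 * (1 / w) ^ 3
      = (c3 + c2 * w + c1 * w ^ 2 + c0 * w ^ 3) / w ^ 3"
    using w0 by (simp add: field_simps power2_eq_square power3_eq_cube)
  thus ?thesis using w w0
    by (intro exI[of _ "1 / w"]) (simp add: absv_divide, simp add: field_simps)
qed

end

section \<open>Rationality of isolated fixed points\<close>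

locale rational_cubic_with_fixed_points = cubic_with_fixed_points u b f a p0 p1 p2 +
    base: normalized_henselian_field v b
  for v :: "'k :: field \<Rightarrow> ereal" and u :: "'c :: field \<Rightarrow> ereal" and b f a p0 p1 p2 +
  fixes \<iota> :: "'k \<Rightarrow> 'c" and \<phi> :: "'k poly"
  assumes \<iota>_add: "\<iota> (x + y) = \<iota> x + \<iota> y" and \<iota>_mult: "\<iota> (x * y) = \<iota> x * \<iota> y"
    and \<iota>_1: "\<iota> 1 = 1" and u_\<iota>: "u (\<iota> x) = v x"
    and f_rational: "f = map_poly \<iota> \<phi>"
begin

lemma \<iota>_0 [simp]: "\<iota> 0 = 0"
  using \<iota>_add[of 0 0] by (metis add_0 add_cancel_right_right)

lemma \<iota>_diff: "\<iota> (x - y) = \<iota> x - \<iota> y"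
  using \<iota>_add[of "x - y" y] by (simp add: algebra_simps)

lemma \<iota>_power: "\<iota> (x ^ n) = \<iota> x ^ n"
  by (induction n) (auto simp: \<iota>_1 \<iota>_mult)

lemma \<iota>_eq_0_iff [simp]: "\<iota> x = 0 \<longleftrightarrow> x = 0"
  using u_\<iota>[of x] val_eq_PInf_iff[of "\<iota> x"] base.val_eq_PInf_iff[of x] by simp

lemma absv_\<iota> [simp]: "absv (\<iota> x) = base.absv x"
  by (simp add: val_abs_def u_\<iota>)

lemma small_elements_exist:
  assumes "\<delta> > 0"
  shows "\<exists>h. 0 < absv h \<and> absv h < \<delta>"
  using base.small_elements_exist[OF assms] absv_\<iota> by metis

text \<open>
  The coefficients of \<open>f z - z\<close>, expanded at a rational point \<open>x\<close>, are rational; they are here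
  expressed by Vieta's formulas through the positions of the fixed points relative to \<open>x\<close>. In
  \<open>g1\<close> and \<open>g2\<close> the summand that dominates in the applications is bracketed apart.
\<close>

lemma recentred_coefficients:
  fixes x :: 'k
  defines "q0 \<equiv> p0 - \<iota> x" and "q1 \<equiv> p1 - \<iota> x" and "q2 \<equiv> p2 - \<iota> x"
  obtains g0 g1 g2 g3 where
    "\<iota> g0 = - (a * (q0 * q1 * q2))" "\<iota> g1 = a * (q1 * q2 + (q0 * q1 + q0 * q2))"
    "\<iota> g2 = - (a * (q0 + (q1 + q2)))" "\<iota> g3 = a"
proof -
  obtain d0 d1 d2 d3 \<psi> where \<phi>: "\<phi> = pCons d0 (pCons d1 (pCons d2 (pCons d3 \<psi>)))"
    by (metis pCons_cases)
  have "pCons (\<iota> d0) (pCons (\<iota> d1) (pCons (\<iota> d2) (pCons (\<iota> d3) (map_poly \<iota> \<psi>)))) = f"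
    by (simp add: f_rational \<phi> map_poly_pCons)
  also have "f = [:- (a * (p0 * p1 * p2)), 1 + a * (p1 * p2 + (p0 * p1 + p0 * p2)),
      - (a * (p0 + (p1 + p2))), a:]" by (simp add: f_eq algebra_simps)
  finally have d: "\<iota> d0 = - (a * (p0 * p1 * p2))" "\<iota> d1 = 1 + a * (p1 * p2 + (p0 * p1 + p0 * p2))"
      "\<iota> d2 = - (a * (p0 + (p1 + p2)))" "\<iota> d3 = a" by auto
  show ?thesis
  proof
    show "\<iota> (d0 + d1 * x + d2 * x ^ 2 + d3 * x ^ 3 - x) = - (a * (q0 * q1 * q2))"
      by (simp only: \<iota>_add \<iota>_mult \<iota>_diff \<iota>_power d q0_def q1_def q2_def,
          simp add: algebra_simps power2_eq_square power3_eq_cube)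
    show "\<iota> (d1 - 1 + (d2 + d2) * x + (d3 + d3 + d3) * x ^ 2)
        = a * (q1 * q2 + (q0 * q1 + q0 * q2))"
      by (simp only: \<iota>_add \<iota>_mult \<iota>_diff \<iota>_power \<iota>_1 d q0_def q1_def q2_def,
          simp add: algebra_simps power2_eq_square power3_eq_cube)
    show "\<iota> (d2 + (d3 + d3 + d3) * x) = - (a * (q0 + (q1 + q2)))"
      by (simp only: \<iota>_add \<iota>_mult d q0_def q1_def q2_def, simp add: algebra_simps)
    show "\<iota> d3 = a" by (rule d)
  qed
qed

text \<open>
  As seen from the rational point \<open>x\<close>, the fixed point \<open>p0\<close> is strictly nearer, or strictly more
  distant, than the two others. By Vieta's formulas the recentred cubic then satisfies the
  hypotheses for an isolated small, respectively large, root in \<open>K\<close>, and the absolute value of that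
  root distinguishes it from \<open>p1\<close> and \<open>p2\<close>.
\<close>

lemma isolated_fixed_point_rational:
  assumes "absv (p0 - \<iota> x) < R \<and> absv (p1 - \<iota> x) = R \<and> absv (p2 - \<iota> x) = R \<or>
           absv (p0 - \<iota> x) = R \<and> absv (p1 - \<iota> x) < R \<and> absv (p2 - \<iota> x) < R"
  shows "p0 \<in> range \<iota>"
proof -
  define q0 where "q0 = p0 - \<iota> x"
  define q1 where "q1 = p1 - \<iota> x"
  define q2 where "q2 = p2 - \<iota> x"
  obtain g0 g1 g2 g3 where g:
    "\<iota> g0 = - (a * (q0 * q1 * q2))" "\<iota> g1 = a * (q1 * q2 + (q0 * q1 + q0 * q2))"
    "\<iota> g2 = - (a * (q0 + (q1 + q2)))" "\<iota> g3 = a"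
    using recentred_coefficients unfolding q0_def q1_def q2_def by blast
  have abs_g: "base.absv g0 = absv a * (absv q0 * absv q1 * absv q2)"
    "base.absv g1 = absv a * absv (q1 * q2 + (q0 * q1 + q0 * q2))"
    "base.absv g2 = absv a * absv (q0 + (q1 + q2))" "base.absv g3 = absv a"
    by (simp_all only: absv_\<iota>[symmetric] g absv_minus absv_mult)
  define \<alpha> where "\<alpha> = absv a"
  have \<alpha>: "\<alpha> > 0" using a_nonzero by (simp add: \<alpha>_def)
  have R: "R > 0" using assms absv_nonneg le_less_trans by metis
  have root: "\<iota> z \<in> {q0, q1, q2}" if "g0 + g1 * z + g2 * z ^ 2 + g3 * z ^ 3 = 0" for z
  proof -
    have "a * ((\<iota> z - q0) * (\<iota> z - q1) * (\<iota> z - q2)) =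
        \<iota> (g0 + g1 * z + g2 * z ^ 2 + g3 * z ^ 3)"
      by (simp add: \<iota>_add \<iota>_mult \<iota>_power g algebra_simps power2_eq_square power3_eq_cube)
    thus ?thesis using a_nonzero that by auto
  qed
  consider (near) "absv q0 < R" "absv q1 = R" "absv q2 = R"
    | (distant) "absv q0 = R" "absv q1 < R" "absv q2 < R"
    using assms unfolding q0_def q1_def q2_def by blast
  then obtain z where "\<iota> z = q0"
  proof cases
    case near
    have "absv (q0 * q1 + q0 * q2) < absv (q1 * q2)"
      using near R by (intro absv_add_less) (simp_all add: absv_mult)
    hence "absv (q1 * q2 + (q0 * q1 + q0 * q2)) = R * R"
      using absv_add_eq[of "q0 * q1 + q0 * q2" "q1 * q2"] near by (simp add: absv_mult add.commute)
    hence g1: "base.absv g1 = \<alpha> * (R * R)" by (simp add: abs_g \<alpha>_def)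
    have g0: "base.absv g0 = \<alpha> * (R * R) * absv q0" using near by (simp add: abs_g \<alpha>_def)
    have "absv (q0 + (q1 + q2)) \<le> R" using near by (intro absv_add_le) auto
    hence g2: "base.absv g2 \<le> \<alpha> * R" using \<alpha> by (simp add: abs_g \<alpha>_def)
    have "base.absv (g0 * g2) \<le> (\<alpha> * (R * R) * absv q0) * (\<alpha> * R)"
      using g0 g2 \<alpha> R by (simp add: base.absv_mult mult_left_mono)
    also have "\<dots> = \<alpha> ^ 2 * R ^ 3 * absv q0" by (simp add: power2_eq_square power3_eq_cube)
    also have "\<dots> < \<alpha> ^ 2 * R ^ 3 * R" using near \<alpha> R by (intro mult_strict_left_mono) auto
    also have "\<dots> = base.absv g1 ^ 2" by (simp add: g1 power2_eq_square power3_eq_cube)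
    finally have 1: "base.absv (g0 * g2) < base.absv g1 ^ 2" .
    have "base.absv (g0 ^ 2 * g3) = \<alpha> ^ 3 * R ^ 4 * absv q0 ^ 2"
      by (simp add: base.absv_mult base.absv_power g0 abs_g(4) \<alpha>_def[symmetric] field_simps
          power2_eq_square power3_eq_cube power4_eq_xxxx)
    also have "\<dots> < \<alpha> ^ 3 * R ^ 4 * R ^ 2"
      using near \<alpha> R by (intro mult_strict_left_mono power_strict_mono) auto
    also have "\<dots> = base.absv g1 ^ 3"
      by (simp add: g1 power2_eq_square power3_eq_cube power4_eq_xxxx)
    finally have 2: "base.absv (g0 ^ 2 * g3) < base.absv g1 ^ 3" .
    obtain z where z: "g0 + g1 * z + g2 * z ^ 2 + g3 * z ^ 3 = 0"
      "base.absv g1 * base.absv z = base.absv g0"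
      using base.cubic_has_isolated_small_root[OF 1 2] by blast
    have "absv (\<iota> z) = absv q0" using z(2) \<alpha> R by (simp add: g0 g1)
    hence "\<iota> z = q0" using root[OF z(1)] near by auto
    thus ?thesis by (rule that)
  next
    case distant
    have "absv (q1 + q2) < R" using distant by (intro absv_add_less) auto
    hence "absv (q0 + (q1 + q2)) = R"
      using absv_add_eq[of "q1 + q2" q0] distant by (simp add: add.commute)
    hence g2: "base.absv g2 = \<alpha> * R" by (simp add: abs_g \<alpha>_def)
    have q12: "absv q1 * absv q2 < R * R" using distant by (intro mult_strict_mono') auto
    have "absv (q1 * q2 + (q0 * q1 + q0 * q2)) < R * R"
      using distant R q12 by (intro absv_add_less) (simp_all add: absv_mult)
    hence "base.absv (g3 * g1) < \<alpha> * (\<alpha> * (R * R))"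
      using \<alpha> by (simp add: base.absv_mult abs_g \<alpha>_def)
    also have "\<dots> = base.absv g2 ^ 2" by (simp add: g2 power2_eq_square)
    finally have 1: "base.absv (g3 * g1) < base.absv g2 ^ 2" .
    have "base.absv (g3 ^ 2 * g0) = \<alpha> ^ 3 * R * (absv q1 * absv q2)"
      using distant by (simp add: base.absv_mult base.absv_power abs_g \<alpha>_def[symmetric]
          power2_eq_square power3_eq_cube)
    also have "\<dots> < \<alpha> ^ 3 * R * (R * R)" using q12 \<alpha> R by (intro mult_strict_left_mono) auto
    also have "\<dots> = base.absv g2 ^ 3" by (simp add: g2 power3_eq_cube)
    finally have 2: "base.absv (g3 ^ 2 * g0) < base.absv g2 ^ 3" .
    have "g3 \<noteq> 0" using g(4) a_nonzero by auto
    then obtain z where z: "g0 + g1 * z + g2 * z ^ 2 + g3 * z ^ 3 = 0"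
      "base.absv g3 * base.absv z = base.absv g2"
      using base.cubic_has_isolated_large_root[OF 1 2] by blast
    have "absv (\<iota> z) = absv q0" using z(2) \<alpha> distant by (simp add: g2 abs_g(4) \<alpha>_def)
    hence "\<iota> z = q0" using root[OF z(1)] distant by auto
    thus ?thesis by (rule that)
  qed
  hence "p0 = \<iota> (x + z)" by (simp add: \<iota>_add q0_def)
  thus ?thesis by blast
qed

end

section \<open>Fixed points of a cubic in the completed algebraic closure\<close>

lemma cubic_splits_over_alg_closed_field:
  fixes g :: "'a :: alg_closed_field poly"
  assumes "Polynomial.degree g = 3"
  obtains a p0 p1 p2 where "a \<noteq> 0"
    "g = Polynomial.smult a ([:- p0, 1:] * [:- p1, 1:] * [:- p2, 1:])"
proof -
  have "g \<noteq> 0" using assms by auto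
  then obtain A where A: "size A = Polynomial.degree g"
    "g = Polynomial.smult (Polynomial.lead_coeff g) (\<Prod>x\<in>#A. [:- x, 1:])"
    using alg_closed_imp_factorization by blast
  obtain xs where xs: "mset xs = A" using ex_mset by blast
  have "length xs = 3" using A(1) assms by (simp flip: xs)
  then obtain p0 p1 p2 where "xs = [p0, p1, p2]" by (auto simp: numeral_3_eq_3 length_Suc_conv)
  hence "(\<Prod>x\<in>#A. [:- x, 1:]) = [:- p0, 1:] * [:- p1, 1:] * [:- p2, 1:]"
    unfolding xs[symmetric] by (simp add: mult.assoc del: mult_pCons_left mult_pCons_right)
  thus ?thesis using that[of "Polynomial.lead_coeff g" p0 p1 p2] A(2) \<open>g \<noteq> 0\<close> by simp
qed

text \<open>
  The cubic \<open>\<phi> z - z\<close> splits over the algebraic closure of \<open>K\<close>, and its factorisation is carried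
  over by the embedding \<open>j\<close>. In this way no root needs to be found in the completion itself.
\<close>

lemma cubic_fixed_points_in_completion:
  fixes \<phi> :: "'k :: field poly" and j :: "'k alg_closure \<Rightarrow> 'c :: field"
  assumes "completed_alg_closure v w u j b" and deg: "Polynomial.degree \<phi> = 3"
  obtains a p0 p1 p2 where "a \<noteq> 0"
    "map_poly (\<lambda>x. j (to_ac x)) \<phi> =
       [:0, 1:] + Polynomial.smult a ([:- p0, 1:] * [:- p1, 1:] * [:- p2, 1:])"
proof -
  interpret completed_alg_closure v w u j b by fact
  have j_0 [simp]: "j 0 = 0" using j_add[of 0 0] by (metis add_0 add_cancel_right_right)
  have j_minus: "j (- x) = - j x" for x using j_add[of x "- x"] by (simp add: eq_neg_iff_add_eq_0 add.commute)
  have j_eq_0: "j x = 0 \<longleftrightarrow> x = 0" for x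
    using u_extends[of x] compl.val_eq_PInf_iff[of "j x"] closure.val_eq_PInf_iff[of x] by simp
  obtain d0 d1 d2 d3 \<psi> where \<phi>': "\<phi> = pCons d0 (pCons d1 (pCons d2 (pCons d3 \<psi>)))"
    by (metis pCons_cases)
  have "\<psi> = 0" using deg by (auto simp: \<phi>' split: if_splits)
  hence \<phi>: "\<phi> = [:d0, d1, d2, d3:]" and d3: "d3 \<noteq> 0"
    using \<phi>' deg by (auto split: if_splits)
  define g where "g = [:to_ac d0, to_ac d1 - 1, to_ac d2, to_ac d3:]"
  have "Polynomial.degree g = 3" using d3 by (simp add: g_def)
  then obtain a p0 p1 p2 where g: "a \<noteq> 0"
      "g = Polynomial.smult a ([:- p0, 1:] * [:- p1, 1:] * [:- p2, 1:])"
    by (rule cubic_splits_over_alg_closed_field)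
  have "g = [:- (a * (p0 * p1 * p2)), a * (p1 * p2 + (p0 * p1 + p0 * p2)),
      - (a * (p0 + (p1 + p2))), a:]" unfolding g(2) by (simp add: algebra_simps)
  hence d: "to_ac d0 = - (a * (p0 * p1 * p2))" "to_ac d1 = 1 + a * (p1 * p2 + (p0 * p1 + p0 * p2))"
      "to_ac d2 = - (a * (p0 + (p1 + p2)))" "to_ac d3 = a" by (auto simp: g_def diff_eq_eq add.commute)
  have "map_poly (\<lambda>x. j (to_ac x)) \<phi> =
      [:0, 1:] + Polynomial.smult (j a) ([:- j p0, 1:] * [:- j p1, 1:] * [:- j p2, 1:])"
    by (simp add: \<phi> map_poly_pCons)
      (simp only: d j_add j_mult j_minus j_one, simp add: algebra_simps)
  thus ?thesis using that[of "j a"] g(1) j_eq_0 by blast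
qed

section \<open>The rational Julia set of a cubic\<close>

lemma repelling_rational_fixed_point_if_isolated:
  assumes "rational_cubic_with_fixed_points v u b f a q0 q1 q2 \<iota> \<phi>"
    and "val_abs b u (q0 - q1) = R" "val_abs b u (q0 - q2) = R" "1 < val_abs b u a * R ^ 2"
    and "val_abs b u (q0 - \<iota> x) < R \<and> val_abs b u (q1 - \<iota> x) = R \<and> val_abs b u (q2 - \<iota> x) = R \<or>
         val_abs b u (q0 - \<iota> x) = R \<and> val_abs b u (q1 - \<iota> x) < R \<and> val_abs b u (q2 - \<iota> x) < R"
  shows "repelling_fixed_point u f q0 \<and> Aff q0 \<in> rational_julia_set (val_abs b u) \<iota> \<phi>"
proof -
  interpret rational_cubic_with_fixed_points v u b f a q0 q1 q2 \<iota> \<phi> by fact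
  obtain y where "q0 = \<iota> y" using isolated_fixed_point_rational[OF assms(5)] by blast
  hence "Aff q0 = map_proj_line \<iota> (Aff y)" by simp
  thus ?thesis
    using isolated_fixed_point_repelling[OF assms(2-4)]
      isolated_fixed_point_in_julia_set[OF assms(2-4) small_elements_exist]
    unfolding rational_julia_set_def f_rational by blast
qed

theorem theorem2p2:
  fixes v :: "'k :: field \<Rightarrow> ereal"
    and w :: "'k alg_closure \<Rightarrow> ereal"
    and u :: "'c :: field \<Rightarrow> ereal"
    and j :: "'k alg_closure \<Rightarrow> 'c"
    and b :: real
    and \<phi> :: "'k poly"
  defines "\<iota> \<equiv> (\<lambda>x. j (to_ac x))"
  assumes "henselian_discrete_field v"
    and "completed_alg_closure v w u j b"
    and "Polynomial.degree \<phi> = 3"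
    and "rational_julia_set (val_abs b u) \<iota> \<phi> \<noteq> {}"
  shows "\<exists>z. repelling_fixed_point u (map_poly \<iota> \<phi>) z \<and>
             Aff z \<in> rational_julia_set (val_abs b u) \<iota> \<phi>"
proof -
  define f where "f = map_poly \<iota> \<phi>"
  interpret C: completed_alg_closure v w u j b by fact
  interpret K: henselian_discrete_field v by fact
  obtain a p0 p1 p2 where a: "a \<noteq> 0"
    and f: "f = [:0, 1:] + Polynomial.smult a ([:- p0, 1:] * [:- p1, 1:] * [:- p2, 1:])"
    using cubic_fixed_points_in_completion[OF assms(3,4)] unfolding f_def \<iota>_def by metis
  have rational_cubic: "rational_cubic_with_fixed_points v u b f a q0 q1 q2 \<iota> \<phi>"
    if "[:- q0, 1:] * [:- q1, 1:] * [:- q2, 1:] = [:- p0, 1:] * [:- p1, 1:] * [:- p2, 1:]"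
    for q0 q1 q2
  proof unfold_locales
    show "b > 1" by (rule C.base_gt_1)
    show "a \<noteq> 0" by (rule a)
    show "f = [:0, 1:] + Polynomial.smult a ([:- q0, 1:] * [:- q1, 1:] * [:- q2, 1:])"
      unfolding that by (rule f)
  qed (simp_all add: f_def \<iota>_def C.j_add C.j_mult C.j_one C.u_extends C.w_extends)
  interpret rational_cubic_with_fixed_points v u b f a p0 p1 p2 \<iota> \<phi>
    by (rule rational_cubic) (rule refl)
  define R where "R = max (absv (p1 - p0)) (absv (p2 - p0))"
  obtain x where x: "Aff (\<iota> x) \<in> julia_set absv (poly_map f)"
  proof -
    obtain P where "P \<in> julia_set absv (poly_map f)" "P \<in> range (map_proj_line \<iota>)"
      using assms(5) unfolding rational_julia_set_def f_def by blast
    moreover from this obtain Q where "P = map_proj_line \<iota> Q" by blast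
    ultimately show ?thesis using that Infty_not_in_julia_set by (cases Q) auto
  qed
  \<comment> \<open>Otherwise the Julia set would be empty.\<close>
  have R_large: "1 < absv a * R ^ 2"
  proof (rule ccontr)
    assume small: "\<not> 1 < absv a * R ^ 2"
    have "absv a * absv (q - p0) ^ 2 \<le> 1" if "absv (q - p0) \<le> R" for q
      using mult_left_mono[OF power_mono[OF that, of 2], of "absv a"] small by simp
    thus False using julia_set_empty_if_fixed_points_close x by (simp add: R_def)
  qed
  have not_far: "\<not> far (\<iota> x)" "\<not> far (poly f (\<iota> x))"
    using escaping_not_in_julia_set[of 0 "\<iota> x"] escaping_not_in_julia_set[of 1 "\<iota> x"] x by auto
  have far: "far z" if "R < absv (z - p0)" for z
  proof -
    have "absv a * R ^ 2 \<le> absv a * absv (z - p0) ^ 2"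
      using that by (intro mult_left_mono power_mono) (auto simp: R_def le_max_iff_disj)
    thus ?thesis using that R_large by (auto simp: far_def R_def)
  qed
  have p: "absv (p1 - p0) \<le> R" "absv (p2 - p0) \<le> R" by (auto simp: R_def)
  have x0: "absv (p0 - \<iota> x) \<le> R" using far not_far(1) absv_commute not_le by metis
  have x12: "absv (p1 - \<iota> x) \<le> R" "absv (p2 - \<iota> x) \<le> R"
    using p x0 absv_triangle_le by blast+
  \<comment> \<open>Here \<open>\<bar>f x - p0\<bar> = \<bar>a\<bar> R\<^sup>3 > R\<close>, so that \<open>x\<close> would escape after one step.\<close>
  have not_all: "\<not> (absv (p0 - \<iota> x) = R \<and> absv (p1 - \<iota> x) = R \<and> absv (p2 - \<iota> x) = R)"
  proof
    assume eq: "absv (p0 - \<iota> x) = R \<and> absv (p1 - \<iota> x) = R \<and> absv (p2 - \<iota> x) = R"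
    hence eq': "absv (\<iota> x - p0) = R" "absv (\<iota> x - p1) = R" "absv (\<iota> x - p2) = R"
      by (auto simp: absv_commute[of "\<iota> x"])
    have "R \<ge> 0" "R \<noteq> 0" using R_large order_trans[OF absv_nonneg p(1)] by auto
    hence "R > 0" by simp
    moreover have "absv (poly f (\<iota> x) - p0) = absv a * R ^ 2 * R"
      using expansion_from_p0[of "\<iota> x"] R_large eq' by (simp add: power2_eq_square mult.assoc)
    ultimately have "R < absv (poly f (\<iota> x) - p0)"
      using mult_strict_right_mono[OF R_large, of R] by simp
    thus False using far not_far(2) by blast
  qed
  \<comment> \<open>Otherwise both \<open>\<bar>p1 - p0\<bar>\<close> and \<open>\<bar>p2 - p0\<bar>\<close> would be less than \<open>R\<close>.\<close>
  have not_all_near: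
    "\<not> (absv (p0 - \<iota> x) < R \<and> absv (p1 - \<iota> x) < R \<and> absv (p2 - \<iota> x) < R)"
    using absv_triangle_less[of p1 "\<iota> x" R p0] absv_triangle_less[of p2 "\<iota> x" R p0]
    by (auto simp: absv_commute[of "\<iota> x"] R_def)
  have apart: "absv (p - q) = R" if "absv (p - \<iota> x) < R" "absv (q - \<iota> x) = R" for p q
    using absv_isosceles[of p "\<iota> x" q] that by (simp add: absv_commute[of "\<iota> x"])
  \<comment> \<open>The locale singles out its first fixed point, hence any of the three may be put first.\<close>
  have isolated: "\<exists>z. repelling_fixed_point u f z \<and> Aff z \<in> rational_julia_set absv \<iota> \<phi>"
    if "[:- q0, 1:] * [:- q1, 1:] * [:- q2, 1:] = [:- p0, 1:] * [:- p1, 1:] * [:- p2, 1:]"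
      and q: "absv (q0 - \<iota> x) < R \<and> absv (q1 - \<iota> x) = R \<and> absv (q2 - \<iota> x) = R \<or>
        absv (q0 - \<iota> x) = R \<and> absv (q1 - \<iota> x) < R \<and> absv (q2 - \<iota> x) < R"
    for q0 q1 q2
  proof -
    have "absv (q0 - q1) = R" "absv (q0 - q2) = R"
      using q apart absv_commute by metis+
    thus ?thesis
      using repelling_rational_fixed_point_if_isolated[OF rational_cubic[OF that(1)] _ _ R_large q]
      by blast
  qed
  have perm: "[:- p1, 1:] * [:- p0, 1:] * [:- p2, 1:] = [:- p0, 1:] * [:- p1, 1:] * [:- p2, 1:]"
    "[:- p2, 1:] * [:- p0, 1:] * [:- p1, 1:] = [:- p0, 1:] * [:- p1, 1:] * [:- p2, 1:]"
    by (simp_all only: ac_simps)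
  show ?thesis unfolding f_def[symmetric]
    using isolated[OF refl] isolated[OF perm(1)] isolated[OF perm(2)] x0 x12 not_all not_all_near
    by (smt (verit))
qed

end
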